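(* Let $S:\operatorname{dom} S\subseteq \ell^2\to\ell^2$ be the linear operator with $$\operatorname{dom} S=\Big\{y=(y_n)_{n\ge 1}\in\ell^2 \;\Big|\; \sum_{i\ge 1}y_i=0,\ \Big(\sum_{i\le n}y_i\Big)_{n\ge 1}\in\ell^2\Big\},\qquad Sy=\Big(\sum_{i<n}y_i+\tfrac12 y_n\Big)_{n\ge 1}\quad (y\in\operatorname{dom} S).$$ Then $S$ is maximal skew, but $-S^*$ is not monotone, and hence not maximal monotone.
   Context: $\ell^2$ is the real Hilbert space of square-summable real sequences $(x_1,x_2,\dots)$ with inner product $\langle\cdot,\cdot\rangle$. Infinite series are limits of partial sums, and $\sum_{i<1}y_i=0$. For a real Hilbert space $X$ and a set-valued operator $A:X\rightrightarrows X$, $\operatorname{gra}A=\{(x,x^* )\in X\times X\mid x^*\in Ax\}$. A linear single-valued operator with domain $\operatorname{dom}S$ is identified with the at most single-valued set-valued operator having the same graph. $A$ is a linear relation if $\operatorname{gra}A$ is a linear subspace. $A$ is monotone if $\langle x-y,x^*-y^*\rangle\ge 0$ for all $(x,x^* ),(y,y^* )\in\operatorname{gra}A$, and maximal monotone if it is monotone and no proper enlargement (in the sense of graph inclusion) of $A$ is monotone. A linear relation $A$ is skew if $\langle x,x^*\rangle=0$ for all $(x,x^* )\in\operatorname{gra}A$; a skew $A$ is maximal skew if no proper enlargement (in the sense of graph inclusion) of $A$ is skew. The adjoint $A^*$ of a linear relation $A$ is defined by $\operatorname{gra}A^*=\{(x,x^* )\mid (x^*,-x)\in(\operatorname{gra}A)^\perp\}$,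 and $\operatorname{gra}(-A)=\{(x,-x^* )\mid (x,x^* )\in\operatorname{gra}A\}$. *)

theory Defs
  imports "HOL-Analysis.Analysis"
begin

section \<open>The real Hilbert space of square-summable sequences\<close>

text \<open>
  Sequences are indexed from \<open>0\<close>: the entry \<open>ell2_nth x n\<close> is the mathematical
  \<open>x_{n+1}\<close>.  Thus \<open>{..<n}\<close> below is the set of indices strictly before the current
  one, and is empty at the first entry.
\<close>

typedef ell2 = "{x :: nat \<Rightarrow> real. summable (\<lambda>n. (x n)\<^sup>2)}"
  morphisms ell2_nth Abs_ell2
  by (rule exI[of _ "\<lambda>_. 0"]) simp

setup_lifting type_definition_ell2

lemma ell2_eqI: "(\<And>n. ell2_nth x n = ell2_nth y n) \<Longrightarrow> x = y"
  by transfer auto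

lemma summable_ell2_nth: "summable (\<lambda>n. (ell2_nth x n)\<^sup>2)"
  by transfer simp

lemma summable_square_mult:
  fixes x y :: "nat \<Rightarrow> real"
  assumes "summable (\<lambda>n. (x n)\<^sup>2)" "summable (\<lambda>n. (y n)\<^sup>2)"
  shows "summable (\<lambda>n. x n * y n)"
proof (rule summable_comparison_test'[where N = 0])
  show "summable (\<lambda>n. (x n)\<^sup>2 + (y n)\<^sup>2)"
    using assms by (rule summable_add)
  fix n :: nat
  have "2 * (\<bar>x n\<bar> * \<bar>y n\<bar>) \<le> \<bar>x n\<bar>\<^sup>2 + \<bar>y n\<bar>\<^sup>2"
    using sum_squares_bound[of "\<bar>x n\<bar>" "\<bar>y n\<bar>"] by (simp add: mult.assoc)
  moreover have "0 \<le> \<bar>x n\<bar> * \<bar>y n\<bar>" by simp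
  ultimately have "\<bar>x n\<bar> * \<bar>y n\<bar> \<le> \<bar>x n\<bar>\<^sup>2 + \<bar>y n\<bar>\<^sup>2" by linarith
  then show "norm (x n * y n) \<le> (x n)\<^sup>2 + (y n)\<^sup>2"
    by (simp add: abs_mult)
qed

lemma summable_square_add:
  fixes x y :: "nat \<Rightarrow> real"
  assumes "summable (\<lambda>n. (x n)\<^sup>2)" "summable (\<lambda>n. (y n)\<^sup>2)"
  shows "summable (\<lambda>n. (x n + y n)\<^sup>2)"
proof -
  have "summable (\<lambda>n. (x n)\<^sup>2 + (y n)\<^sup>2 + 2 * (x n * y n))"
    using assms by (intro summable_add summable_mult summable_square_mult)
  then show ?thesis
    by (simp add: power2_sum mult.assoc)
qed

lemma summable_square_scale:
  fixes x :: "nat \<Rightarrow> real"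
  assumes "summable (\<lambda>n. (x n)\<^sup>2)"
  shows "summable (\<lambda>n. (c * x n)\<^sup>2)"
  using summable_mult[OF assms, of "c\<^sup>2"] by (simp add: power_mult_distrib)

lemma summable_ell2_mult: "summable (\<lambda>n. ell2_nth x n * ell2_nth y n)"
  by (intro summable_square_mult summable_ell2_nth)

instantiation ell2 :: real_vector
begin

lift_definition zero_ell2 :: ell2 is "\<lambda>_. 0" by simp

lift_definition plus_ell2 :: "ell2 \<Rightarrow> ell2 \<Rightarrow> ell2" is "\<lambda>x y n. x n + y n"
  by (rule summable_square_add)

lift_definition uminus_ell2 :: "ell2 \<Rightarrow> ell2" is "\<lambda>x n. - x n" by simp

lift_definition minus_ell2 :: "ell2 \<Rightarrow> ell2 \<Rightarrow> ell2" is "\<lambda>x y n. x n - y n"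
  subgoal for x y using summable_square_add[of x "\<lambda>n. - y n"] by simp
  done

lift_definition scaleR_ell2 :: "real \<Rightarrow> ell2 \<Rightarrow> ell2" is "\<lambda>c x n. c * x n"
  by (rule summable_square_scale)

instance
proof
  fix x y z :: ell2 and a b :: real
  show "x + y + z = x + (y + z)" by transfer (simp add: add.assoc)
  show "x + y = y + x" by transfer (simp add: add.commute)
  show "0 + x = x" by transfer simp
  show "- x + x = 0" by transfer simp
  show "x - y = x + - y" by transfer simp
  show "a *\<^sub>R (x + y) = a *\<^sub>R x + a *\<^sub>R y" by transfer (simp add: algebra_simps)
  show "(a + b) *\<^sub>R x = a *\<^sub>R x + b *\<^sub>R x" by transfer (simp add: algebra_simps)
  show "a *\<^sub>R b *\<^sub>R x = (a * b) *\<^sub>R x" by transfer (simp add: algebra_simps)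
  show "1 *\<^sub>R x = x" by transfer simp
qed

end

instantiation ell2 :: real_inner
begin

lift_definition inner_ell2 :: "ell2 \<Rightarrow> ell2 \<Rightarrow> real" is "\<lambda>x y. \<Sum>n. x n * y n" .

definition norm_ell2 :: "ell2 \<Rightarrow> real" where "norm_ell2 x = sqrt (inner x x)"

definition dist_ell2 :: "ell2 \<Rightarrow> ell2 \<Rightarrow> real" where "dist_ell2 x y = norm (x - y)"

definition sgn_ell2 :: "ell2 \<Rightarrow> ell2" where "sgn_ell2 x = x /\<^sub>R norm x"

definition uniformity_ell2 :: "(ell2 \<times> ell2) filter"
  where "uniformity_ell2 = (INF e\<in>{0<..}. principal {(x, y). dist x y < e})"

definition open_ell2 :: "ell2 set \<Rightarrow> bool"
  where "open_ell2 U \<longleftrightarrow> (\<forall>x\<in>U. \<forall>\<^sub>F (x', y) in uniformity. x' = x \<longrightarrow> y \<in> U)"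

instance
proof
  fix x y z :: ell2 and a :: real
  show "sgn x = x /\<^sub>R norm x" by (rule sgn_ell2_def)
  show "dist x y = norm (x - y)" by (rule dist_ell2_def)
  show "(uniformity :: (ell2 \<times> ell2) filter) = (INF e\<in>{0<..}. principal {(x, y). dist x y < e})"
    by (rule uniformity_ell2_def)
  show "open U \<longleftrightarrow> (\<forall>x\<in>U. \<forall>\<^sub>F (x', y) in uniformity. x' = x \<longrightarrow> y \<in> U)" for U :: "ell2 set"
    by (rule open_ell2_def)
  show "inner x y = inner y x" by transfer (simp add: mult.commute)
  show "inner (x + y) z = inner x z + inner y z"
    by transfer (simp add: distrib_right suminf_add summable_square_mult)
  show "inner (a *\<^sub>R x) y = a * inner x y"
    by transfer (simp add: mult.assoc suminf_mult summable_square_mult)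
  show "0 \<le> inner x x"
    by transfer (simp add: suminf_nonneg flip: power2_eq_square)
  show "inner x x = 0 \<longleftrightarrow> x = 0"
    by transfer (auto simp: suminf_eq_zero_iff fun_eq_iff simp flip: power2_eq_square)
  show "norm x = sqrt (inner x x)" by (rule norm_ell2_def)
qed

end

lemma norm_ell2_square: "(norm x)\<^sup>2 = (\<Sum>n. (ell2_nth x n)\<^sup>2)" for x :: ell2
  unfolding power2_norm_eq_inner inner_ell2.rep_eq by (simp add: power2_eq_square)

lemma sum_le_norm_ell2: "(\<Sum>n<N. (ell2_nth x n)\<^sup>2) \<le> (norm x)\<^sup>2"
  unfolding norm_ell2_square
  by (rule sum_le_suminf) (auto intro: summable_ell2_nth)

lemma abs_ell2_nth_le_norm: "\<bar>ell2_nth x n\<bar> \<le> norm x"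
proof -
  have "(ell2_nth x n)\<^sup>2 \<le> (\<Sum>k<Suc n. (ell2_nth x k)\<^sup>2)"
    by (simp add: sum_nonneg)
  also have "\<dots> \<le> (norm x)\<^sup>2" by (rule sum_le_norm_ell2)
  finally show ?thesis using abs_le_square_iff[of "ell2_nth x n" "norm x"] by simp
qed

instance ell2 :: complete_space
proof
  fix X :: "nat \<Rightarrow> ell2"
  assume X: "Cauchy X"
  have "Cauchy (\<lambda>m. ell2_nth (X m) n)" for n
  proof (rule metric_CauchyI)
    fix e :: real assume "0 < e"
    then obtain M where M: "\<And>m k. m \<ge> M \<Longrightarrow> k \<ge> M \<Longrightarrow> dist (X m) (X k) < e"
      using X unfolding Cauchy_def by blast
    show "\<exists>M. \<forall>m\<ge>M. \<forall>k\<ge>M. dist (ell2_nth (X m) n) (ell2_nth (X k) n) < e"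
    proof (intro exI allI impI)
      fix m k assume "m \<ge> M" "k \<ge> M"
      then have "norm (X m - X k) < e"
        using M by (simp add: dist_norm)
      with abs_ell2_nth_le_norm[of "X m - X k" n]
      show "dist (ell2_nth (X m) n) (ell2_nth (X k) n) < e"
        by (simp add: minus_ell2.rep_eq dist_real_def)
    qed
  qed
  then have "\<exists>l. (\<lambda>m. ell2_nth (X m) n) \<longlonglongrightarrow> l" for n
    using Cauchy_convergent_iff convergent_def by blast
  then obtain l where l: "\<And>n. (\<lambda>m. ell2_nth (X m) n) \<longlonglongrightarrow> l n"
    by metis
  have bound: "(\<Sum>n<N. (ell2_nth (X m) n - l n)\<^sup>2) \<le> e\<^sup>2"
    if "\<And>k. k \<ge> M \<Longrightarrow> norm (X m - X k) \<le> e" for m M N e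
  proof (rule LIMSEQ_le_const2)
    show "(\<lambda>k. \<Sum>n<N. (ell2_nth (X m) n - ell2_nth (X k) n)\<^sup>2)
      \<longlonglongrightarrow> (\<Sum>n<N. (ell2_nth (X m) n - l n)\<^sup>2)"
      by (intro tendsto_intros l)
    have "(\<Sum>n<N. (ell2_nth (X m) n - ell2_nth (X k) n)\<^sup>2) \<le> e\<^sup>2" if "k \<ge> M" for k
    proof -
      have "(norm (X m - X k))\<^sup>2 \<le> e\<^sup>2"
        using \<open>\<And>k. k \<ge> M \<Longrightarrow> norm (X m - X k) \<le> e\<close>[OF that] by (intro power_mono) auto
      then show ?thesis
        using sum_le_norm_ell2[of "X m - X k" N] by (simp add: minus_ell2.rep_eq)
    qed
    then show "\<exists>K. \<forall>k\<ge>K. (\<Sum>n<N. (ell2_nth (X m) n - ell2_nth (X k) n)\<^sup>2) \<le> e\<^sup>2"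
      by blast
  qed
  have diff_summable: "summable (\<lambda>n. (ell2_nth (X m) n - l n)\<^sup>2)"
    if "\<And>k. k \<ge> M \<Longrightarrow> norm (X m - X k) \<le> e" for m M e
  proof (rule bounded_imp_summable[where B = "e\<^sup>2"])
    show "(\<Sum>k\<le>n. (ell2_nth (X m) k - l k)\<^sup>2) \<le> e\<^sup>2" for n
      using bound[OF that, where N = "Suc n"] unfolding lessThan_Suc_atMost .
  qed simp
  obtain M1 where "\<And>m k. m \<ge> M1 \<Longrightarrow> k \<ge> M1 \<Longrightarrow> dist (X m) (X k) < 1"
    using X unfolding Cauchy_def by (meson zero_less_one)
  then have "summable (\<lambda>n. (ell2_nth (X M1) n - l n)\<^sup>2)"
    by (intro diff_summable[of M1 M1 1]) (auto simp: dist_norm less_imp_le)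
  then have "summable (\<lambda>n. (ell2_nth (X M1) n + (-1) * (ell2_nth (X M1) n - l n))\<^sup>2)"
    by (intro summable_square_add summable_ell2_nth summable_square_scale)
  then have l_summable: "summable (\<lambda>n. (l n)\<^sup>2)" by simp
  define L where "L = Abs_ell2 l"
  have L: "ell2_nth L = l"
    unfolding L_def using l_summable by (intro Abs_ell2_inverse) simp
  have "X \<longlonglongrightarrow> L"
  proof (rule metric_LIMSEQ_I)
    fix e :: real assume e: "0 < e"
    then obtain M where M: "\<And>m k. m \<ge> M \<Longrightarrow> k \<ge> M \<Longrightarrow> dist (X m) (X k) < e / 2"
      using X unfolding Cauchy_def by (meson half_gt_zero)
    have "dist (X m) L < e" if "m \<ge> M" for m
    proof -
      have le: "norm (X m - X k) \<le> e / 2" if "k \<ge> M" for k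
        using M[OF \<open>m \<ge> M\<close> that] by (simp add: dist_norm)
      have "(norm (X m - L))\<^sup>2 \<le> (e / 2)\<^sup>2"
        unfolding norm_ell2_square minus_ell2.rep_eq L
      proof (rule suminf_le_const)
        show "summable (\<lambda>n. (ell2_nth (X m) n - l n)\<^sup>2)"
          by (rule diff_summable[of M m "e / 2"]) (rule le)
        show "(\<Sum>n<N. (ell2_nth (X m) n - l n)\<^sup>2) \<le> (e / 2)\<^sup>2" for N
          by (rule bound[of M m "e / 2"]) (rule le)
      qed
      then have "norm (X m - L) \<le> e / 2"
        by (rule power2_le_imp_le) (use e in simp)
      then show ?thesis using e by (simp add: dist_norm)
    qed
    then show "\<exists>M. \<forall>m\<ge>M. dist (X m) L < e" by blast
  qed
  then show "convergent X" by (rule convergentI)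
qed

section \<open>Set-valued operators\<close>

definition gra :: "('a \<Rightarrow> 'a set) \<Rightarrow> ('a \<times> 'a) set" where
  "gra A = {(x, u). u \<in> A x}"

text \<open>
  The set-valued operator that has the same graph as a single-valued \<open>T\<close> with domain
  \<open>D\<close>; values of \<open>T\<close> outside \<open>D\<close> are irrelevant.
\<close>

definition operator_on :: "'a set \<Rightarrow> ('a \<Rightarrow> 'a) \<Rightarrow> 'a \<Rightarrow> 'a set" where
  "operator_on D T x = (if x \<in> D then {T x} else {})"

definition linear_relation :: "('a::real_inner \<Rightarrow> 'a set) \<Rightarrow> bool" where
  "linear_relation A \<longleftrightarrow> subspace (gra A)"

definition monotone_operator :: "('a::real_inner \<Rightarrow> 'a set) \<Rightarrow> bool" where
  "monotone_operator A \<longleftrightarrow>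
     (\<forall>(x, u) \<in> gra A. \<forall>(y, v) \<in> gra A. inner (x - y) (u - v) \<ge> 0)"

definition maximal_monotone_operator :: "('a::real_inner \<Rightarrow> 'a set) \<Rightarrow> bool" where
  "maximal_monotone_operator A \<longleftrightarrow>
     monotone_operator A \<and> \<not> (\<exists>B. gra A \<subset> gra B \<and> monotone_operator B)"

text \<open>
  Skewness is a notion for linear relations only; hence the enlargements in
  \<open>maximal_skew\<close> range over linear relations as well.
\<close>

definition skew :: "('a::real_inner \<Rightarrow> 'a set) \<Rightarrow> bool" where
  "skew A \<longleftrightarrow> linear_relation A \<and> (\<forall>(x, u) \<in> gra A. inner x u = 0)"

definition maximal_skew :: "('a::real_inner \<Rightarrow> 'a set) \<Rightarrow> bool" where
  "maximal_skew A \<longleftrightarrow> skew A \<and> \<not> (\<exists>B. gra A \<subset> gra B \<and> skew B)"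

definition adjoint_relation :: "('a::real_inner \<Rightarrow> 'a set) \<Rightarrow> 'a \<Rightarrow> 'a set" where
  "adjoint_relation A x = {u. (u, - x) \<in> (gra A)\<^sup>\<bottom>}"

definition neg_relation :: "('a::real_inner \<Rightarrow> 'a set) \<Rightarrow> 'a \<Rightarrow> 'a set" where
  "neg_relation A x = uminus ` A x"

lemma gra_adjoint_relation: "gra (adjoint_relation A) = {(x, u). (u, - x) \<in> (gra A)\<^sup>\<bottom>}"
  by (simp add: gra_def adjoint_relation_def)

lemma gra_neg_relation: "gra (neg_relation A) = {(x, - u) | x u. (x, u) \<in> gra A}"
  by (auto simp: gra_def neg_relation_def)

section \<open>The operator\<close>

definition dom_S :: "ell2 set" where
  "dom_S = {y. (\<lambda>i. ell2_nth y i) sums 0 \<and> summable (\<lambda>n. (\<Sum>i\<le>n. ell2_nth y i)\<^sup>2)}"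

text \<open>
  The sequence below is square-summable for \<open>y \<in> dom_S\<close>, so that \<open>Abs_ell2\<close> is
  meaningful there; see \<open>ell2_nth_S_fun\<close>.
\<close>

definition S_fun :: "ell2 \<Rightarrow> ell2" where
  "S_fun y = Abs_ell2 (\<lambda>n. (\<Sum>i<n. ell2_nth y i) + 1 / 2 * ell2_nth y n)"

definition S :: "ell2 \<Rightarrow> ell2 set" where
  "S = operator_on dom_S S_fun"

lemma ell2_nth_S_fun:
  assumes "y \<in> dom_S"
  shows "ell2_nth (S_fun y) n = (\<Sum>i<n. ell2_nth y i) + 1 / 2 * ell2_nth y n"
proof -
  have "summable (\<lambda>n. ((\<Sum>i\<le>n. ell2_nth y i) + (- 1 / 2) * ell2_nth y n)\<^sup>2)"
    using assms unfolding dom_S_def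
    by (intro summable_square_add summable_square_scale summable_ell2_nth) simp
  moreover have "(\<Sum>i\<le>n. ell2_nth y i) + (- 1 / 2) * ell2_nth y n
      = (\<Sum>i<n. ell2_nth y i) + 1 / 2 * ell2_nth y n" for n
    by (simp flip: lessThan_Suc_atMost)
  ultimately have "summable (\<lambda>n. ((\<Sum>i<n. ell2_nth y i) + 1 / 2 * ell2_nth y n)\<^sup>2)"
    by (simp only:)
  then show ?thesis
    unfolding S_fun_def by (subst Abs_ell2_inverse) simp_all
qed

end

theory Submission
  imports Defs
begin

text \<open>
  A pair \<open>(y, u)\<close> of elements of \<open>\<ell>\<^sup>2\<close> lies in the graph of \<open>S\<close> as soon as
  \<open>u\<^sub>n = (\<Sum>i<n. y\<^sub>i) + y\<^sub>n / 2\<close> for all \<open>n\<close>: the partial sums \<open>\<Sum>i\<le>n. y\<^sub>i = u\<^sub>n + y\<^sub>n / 2\<close>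
  are then square-summable, hence tend to \<open>0\<close>, so that \<open>y \<in> dom S\<close> is automatic
  (\<open>gra_S_iff\<close>).  Skewness holds because \<open>2 y\<^sub>n u\<^sub>n\<close> is the difference of the squares of
  two consecutive partial sums of \<open>y\<close>, and these partial sums tend to \<open>0\<close>.

  Let \<open>(x, u)\<close> belong to a skew extension of \<open>S\<close>.  Skewness polarizes, so
  \<open>\<langle>x, Sy\<rangle> = - \<langle>y, u\<rangle>\<close> for every \<open>y \<in> dom S\<close>.  Testing this with
  \<open>y = e\<^sub>k - e\<^bsub>k+1\<^esub>\<close>, for which \<open>Sy = (e\<^sub>k + e\<^bsub>k+1\<^esub>) / 2\<close>, yields the recursion
  \<open>u\<^bsub>k+1\<^esub> - u\<^sub>k = (x\<^sub>k + x\<^bsub>k+1\<^esub>) / 2\<close>.  It determines \<open>u\<close> from \<open>x\<close> up to the single number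
  \<open>p = u\<^sub>0 - x\<^sub>0 / 2\<close>, and it makes \<open>\<langle>x, u\<rangle>\<close> telescope to \<open>- p\<^sup>2 / 2\<close>
  (\<open>inner_of_recursion\<close>).  Since \<open>\<langle>x, u\<rangle> = 0\<close>, also \<open>p = 0\<close>, which says that \<open>(x, u)\<close> is
  already in the graph of \<open>S\<close>.

  The same recursion, with \<open>p\<close> arbitrary, describes \<open>-S\<^sup>*\<close>, so that \<open>\<langle>x, u\<rangle>\<close> is never positive
  there.  To see a negative value, note that \<open>(Sy)\<^sub>0 = y\<^sub>0 / 2\<close>, so \<open>(e\<^sub>0, e\<^sub>0 / 2)\<close> is in the
  graph of \<open>S\<^sup>*\<close>.  Hence \<open>-S\<^sup>*\<close> contains \<open>(e\<^sub>0, - e\<^sub>0 / 2)\<close> next to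
  \<open>(0, 0)\<close>, and the inner product \<open>- 1 / 2\<close> refutes monotonicity.
\<close>

lift_definition unit_ell2 :: "nat \<Rightarrow> ell2" is "\<lambda>k n. if n = k then 1 else 0"
  by (rule summable_finite[where N = "{k}" for k]) auto

lemma inner_unit_ell2: "inner x (unit_ell2 k) = ell2_nth x k"
proof -
  have "(\<lambda>n. if n = k then ell2_nth x n else 0) sums ell2_nth x k"
    by (rule sums_single)
  moreover have "ell2_nth x n * ell2_nth (unit_ell2 k) n = (if n = k then ell2_nth x n else 0)" for n
    by (simp add: unit_ell2.rep_eq)
  ultimately show ?thesis
    unfolding inner_ell2.rep_eq by (simp add: sums_iff)
qed

lemma ell2_nth_tendsto_0: "ell2_nth x \<longlonglongrightarrow> 0"
proof -
  have "(\<lambda>n. (ell2_nth x n)\<^sup>2) \<longlonglongrightarrow> 0"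
    by (rule summable_LIMSEQ_zero[OF summable_ell2_nth])
  then show ?thesis
    by (simp add: power_tendsto_0_iff)
qed

lemma sums_inner_ell2: "(\<lambda>n. ell2_nth x n * ell2_nth y n) sums inner x y"
  unfolding inner_ell2.rep_eq by (rule summable_sums[OF summable_ell2_mult])

text \<open>
  Membership in \<open>dom_S\<close> follows from the formula for \<open>u\<close>, since \<open>u\<close> and \<open>y\<close> are both
  square-summable and the partial sums of \<open>y\<close> are \<open>u\<^sub>n + y\<^sub>n / 2\<close>.
\<close>

lemma gra_S_iff:
  "(y, u) \<in> gra S \<longleftrightarrow> (\<forall>n. ell2_nth u n = (\<Sum>i<n. ell2_nth y i) + ell2_nth y n / 2)"
proof
  assume "(y, u) \<in> gra S"
  then have "y \<in> dom_S" "u = S_fun y"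
    by (auto simp: gra_def S_def operator_on_def split: if_splits)
  then show "\<forall>n. ell2_nth u n = (\<Sum>i<n. ell2_nth y i) + ell2_nth y n / 2"
    by (simp add: ell2_nth_S_fun)
next
  assume u: "\<forall>n. ell2_nth u n = (\<Sum>i<n. ell2_nth y i) + ell2_nth y n / 2"
  define t where "t = u + (1 / 2) *\<^sub>R y"
  have t: "ell2_nth t = (\<lambda>n. \<Sum>i\<le>n. ell2_nth y i)"
    using u by (simp add: fun_eq_iff t_def plus_ell2.rep_eq scaleR_ell2.rep_eq flip: lessThan_Suc_atMost)
  have "(\<lambda>i. ell2_nth y i) sums 0"
    unfolding sums_def_le using ell2_nth_tendsto_0[of t] by (simp add: t)
  moreover have "summable (\<lambda>n. (\<Sum>i\<le>n. ell2_nth y i)\<^sup>2)"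
    using summable_ell2_nth[of t] by (simp add: t)
  ultimately have y: "y \<in> dom_S"
    by (simp add: dom_S_def)
  have "u = S_fun y"
    by (rule ell2_eqI) (simp add: u ell2_nth_S_fun[OF y])
  with y show "(y, u) \<in> gra S"
    by (simp add: gra_def S_def operator_on_def)
qed

lemma linear_relation_S: "linear_relation S"
  unfolding linear_relation_def
proof (rule subspaceI)
  show "0 \<in> gra S"
    by (simp add: zero_prod_def gra_S_iff zero_ell2.rep_eq)
next
  fix a b assume "a \<in> gra S" "b \<in> gra S"
  then show "a + b \<in> gra S"
    by (cases a; cases b) (simp add: gra_S_iff plus_ell2.rep_eq sum.distrib add_divide_distrib)
next
  fix c :: real and a assume "a \<in> gra S"
  then show "c *\<^sub>R a \<in> gra S"
    by (cases a) (simp add: gra_S_iff scaleR_ell2.rep_eq sum_distrib_left distrib_left)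
qed

lemma sum_telescoping_square:
  fixes y :: "nat \<Rightarrow> real"
  shows "(\<Sum>n<N. y n * ((\<Sum>i<n. y i) + y n / 2)) = (\<Sum>i<N. y i)\<^sup>2 / 2"
  by (induction N) (simp_all add: power2_eq_square field_simps)

lemma skew_S: "skew S"
proof -
  have "inner y u = 0" if yu: "(y, u) \<in> gra S" for y u
  proof -
    have "(\<lambda>i. ell2_nth y i) sums 0"
      using yu by (auto simp: gra_def S_def operator_on_def dom_S_def split: if_splits)
    then have "(\<lambda>N. (\<Sum>i<N. ell2_nth y i)\<^sup>2 / 2) \<longlonglongrightarrow> 0\<^sup>2 / 2"
      unfolding sums_def by (intro tendsto_intros) simp_all
    then have "(\<lambda>n. ell2_nth y n * ell2_nth u n) sums 0"
      using yu by (simp add: sums_def gra_S_iff sum_telescoping_square)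
    then show ?thesis
      using sums_inner_ell2 sums_unique2 by blast
  qed
  then show ?thesis
    by (auto simp: skew_def linear_relation_S)
qed

text \<open>
  In terms of \<open>t\<^sub>n = \<Sum>i\<le>n. y\<^sub>i\<close>, the graph of \<open>S\<close> consists of the pairs with entries
  \<open>(t\<^sub>n - t\<^bsub>n-1\<^esub>, (t\<^sub>n + t\<^bsub>n-1\<^esub>) / 2)\<close>, where \<open>t\<close> ranges over \<open>\<ell>\<^sup>2\<close> and \<open>t\<^bsub>-1\<^esub> = 0\<close>.  The pairs for
  \<open>t = e\<^sub>k\<close> are the test vectors that turn orthogonality to the graph into a recursion.
\<close>

lemma unit_pair_in_gra_S:
  "(unit_ell2 k - unit_ell2 (Suc k), (1 / 2) *\<^sub>R (unit_ell2 k + unit_ell2 (Suc k))) \<in> gra S"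
proof -
  have "(\<Sum>i<n. (if i = k then 1 else 0) - (if i = Suc k then 1 else (0::real)))
      = (if n = Suc k then 1 else 0)" for n
    by (induction n) auto
  then show ?thesis
    by (auto simp: gra_S_iff minus_ell2.rep_eq scaleR_ell2.rep_eq plus_ell2.rep_eq unit_ell2.rep_eq)
qed

text \<open>
  The recursion says that \<open>u\<^sub>n + x\<^sub>n / 2 = u\<^bsub>n+1\<^esub> - x\<^bsub>n+1\<^esub> / 2\<close>.  So with
  \<open>p\<^sub>n = u\<^sub>n - x\<^sub>n / 2\<close>, one has \<open>2 x\<^sub>n u\<^sub>n = (u\<^sub>n + x\<^sub>n / 2)\<^sup>2 - (u\<^sub>n - x\<^sub>n / 2)\<^sup>2 = p\<^bsub>n+1\<^esub>\<^sup>2 - p\<^sub>n\<^sup>2\<close>.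
\<close>

lemma inner_of_recursion:
  assumes rec: "\<And>k. ell2_nth u (Suc k) - ell2_nth u k = (ell2_nth x k + ell2_nth x (Suc k)) / 2"
  shows "inner x u = - (ell2_nth u 0 - ell2_nth x 0 / 2)\<^sup>2 / 2"
proof -
  define p where "p n = ell2_nth u n - ell2_nth x n / 2" for n
  have p_Suc: "p (Suc n) = ell2_nth u n + ell2_nth x n / 2" for n
    using rec[of n] by (simp add: p_def field_simps)
  have "p \<longlonglongrightarrow> 0 - 0 / 2"
    unfolding p_def by (intro tendsto_intros ell2_nth_tendsto_0) simp
  then have "(\<lambda>n. (p n)\<^sup>2 / 2) \<longlonglongrightarrow> 0\<^sup>2 / 2"
    by (intro tendsto_intros) simp_all
  then have "(\<lambda>n. (p (Suc n))\<^sup>2 / 2 - (p n)\<^sup>2 / 2) sums (0\<^sup>2 / 2 - (p 0)\<^sup>2 / 2)"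
    by (rule telescope_sums)
  moreover have "(p (Suc n))\<^sup>2 / 2 - (p n)\<^sup>2 / 2 = ell2_nth x n * ell2_nth u n" for n
    unfolding p_Suc by (simp add: p_def power2_eq_square field_simps)
  ultimately have "(\<lambda>n. ell2_nth x n * ell2_nth u n) sums (- (p 0)\<^sup>2 / 2)"
    by simp
  then show ?thesis
    using sums_inner_ell2[of x u] sums_unique2 unfolding p_def by blast
qed

text \<open>
  Polarization of \<open>\<langle>x, u\<rangle> = 0\<close>, which is possible because the graph is closed under sums.
\<close>

lemma skew_inner_antisymmetric:
  assumes "skew B" "(x, u) \<in> gra B" "(y, v) \<in> gra B"
  shows "inner x v + inner y u = 0"
proof -
  have "(x, u) + (y, v) \<in> gra B"
    using assms by (auto simp: skew_def linear_relation_def simp del: add_Pair intro: subspace_add)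
  then have "inner (x + y) (u + v) = 0" "inner x u = 0" "inner y v = 0"
    using assms by (auto simp: skew_def)
  then show ?thesis
    by (simp add: inner_add_left inner_add_right)
qed

text \<open>
  The recursion alone leaves \<open>u\<^sub>0\<close> free; \<open>\<langle>x, u\<rangle> = 0\<close> fixes it to the value \<open>x\<^sub>0 / 2\<close> that
  \<open>gra_S_iff\<close> asks for.
\<close>

lemma gra_skew_extension_S:
  assumes B: "skew B" and S_B: "gra S \<subseteq> gra B"
  shows "gra B \<subseteq> gra S"
proof (rule subrelI)
  fix x u assume xu: "(x, u) \<in> gra B"
  have rec: "ell2_nth u (Suc k) - ell2_nth u k = (ell2_nth x k + ell2_nth x (Suc k)) / 2" for k
    using skew_inner_antisymmetric[OF B xu subsetD[OF S_B unit_pair_in_gra_S], of k]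
    by (simp add: inner_add_right inner_diff_right inner_unit_ell2 inner_commute[of _ u] field_simps)
  have "inner x u = 0"
    using B xu by (auto simp: skew_def)
  then have u_0: "ell2_nth u 0 = ell2_nth x 0 / 2"
    using inner_of_recursion[OF rec] by simp
  have "ell2_nth u n = (\<Sum>i<n. ell2_nth x i) + ell2_nth x n / 2" for n
  proof (induction n)
    case 0
    show ?case using u_0 by simp
  next
    case (Suc n)
    then show ?case using rec[of n] by (simp add: field_simps)
  qed
  then show "(x, u) \<in> gra S"
    by (simp add: gra_S_iff)
qed

lemma maximal_skew_S: "maximal_skew S"
  unfolding maximal_skew_def using skew_S gra_skew_extension_S by blast

lemma not_monotone_neg_adjoint_S: "\<not> monotone_operator (neg_relation (adjoint_relation S))"
proof
  let ?e = "unit_ell2 0"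
  assume mono: "monotone_operator (neg_relation (adjoint_relation S))"
  have "((1 / 2) *\<^sub>R ?e, - ?e) \<in> (gra S)\<^sup>\<bottom>"
    by (auto simp: orthogonal_comp_def orthogonal_def inner_unit_ell2 gra_S_iff)
  then have "(?e, - ((1 / 2) *\<^sub>R ?e)) \<in> gra (neg_relation (adjoint_relation S))"
    unfolding gra_neg_relation gra_adjoint_relation by blast
  moreover have "(0, 0) \<in> gra (neg_relation (adjoint_relation S))"
    by (auto simp: gra_neg_relation gra_adjoint_relation orthogonal_comp_def orthogonal_def)
  ultimately have "inner (?e - 0) (- ((1 / 2) *\<^sub>R ?e) - 0) \<ge> 0"
    using mono unfolding monotone_operator_def by blast
  then show False
    by (simp add: inner_unit_ell2 unit_ell2.rep_eq)
qed

theorem theorem3p15: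
  shows "maximal_skew S
    \<and> \<not> monotone_operator (neg_relation (adjoint_relation S))
    \<and> \<not> maximal_monotone_operator (neg_relation (adjoint_relation S))"
  using maximal_skew_S not_monotone_neg_adjoint_S
  by (simp add: maximal_monotone_operator_def)

end
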